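(* Let $\mathcal A$ be a poset and let $V$ be a linear injective presheaf on $\mathcal A$ over a commutative field $\mathbb K$. (1) If $V$ satisfies condition (G) and $\mathcal A$ is of locally finite dimension, then $V$ admits an interaction decomposition. (2) If $V$ admits an interaction decomposition, then $V$ satisfies condition (G).
   Context: Posets are viewed as small categories with at most one arrow between two objects and with $\alpha\to\beta\to\alpha$ implying $\alpha=\beta$. The notation $\alpha\xrightarrow{\neq}\beta$ means $\alpha\to\beta$ and $\alpha\ne\beta$; $\gamma\not\to\beta$ means there is no arrow $\gamma\to\beta$. Linear injective presheaf: a contravariant functor $V$ from $\mathcal A$ to $\mathbb K$-vector spaces (no finiteness assumed) such that for every arrow $\alpha\to\beta$ the map $j_{\alpha\beta}:V_\beta\to V_\alpha$ is injective. Write $V_{\alpha\beta}=j_{\alpha\beta}(V_\beta)\subseteq V_\alpha$. Condition (G): for all $\alpha,\beta\in\mathcal A$ with $\alpha\to\beta$, $$V_{\alpha\beta}\cap\Big(\sum_{\gamma:\ \alpha\xrightarrow{\neq}\gamma,\ \gamma\not\to\beta}V_{\alpha\gamma}\Big)\subseteq\sum_{\gamma:\ \alpha\xrightarrow{\neq}\gamma,\ \beta\xrightarrow{\neq}\gamma}V_{\alpha\gamma}.$$ Interaction decomposition of $V$: a family of vector subspaces $S_\gamma\subseteq V_\gamma$, $\gamma\in\mathcal A$, such that $V_\alpha=\bigoplus_{\beta:\alpha\to\beta}j_{\alpha\beta}S_\beta$ for all $\alpha\in\mathcal A$. Locally finite dimension: for every $\alpha\in\mathcal A$, the chains $\alpha\xrightarrow{\neq}\beta_1\xrightarrow{\neq}\beta_2\xrightarrow{\neq}\cdots$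 starting at $\alpha$ are all finite and their lengths are uniformly bounded (with a bound depending on $\alpha$). *)

theory Defs
  imports "Jordan_Normal_Form.Missing_VectorSpace"
begin

text \<open>
  Vector spaces, linear maps and subspaces are the carrier-based ones of \<open>vectorspace\<close>,
  \<open>linear_map\<close> and \<open>subspace\<close>. The poset is a type of class \<open>order\<close>, and an arrow from
  \<open>\<alpha>\<close> to \<open>\<beta>\<close> is read as \<open>\<alpha> \<le> \<beta>\<close>, so that a nontrivial arrow is \<open>\<alpha> < \<beta>\<close>.
\<close>

text \<open>
  The spaces \<open>V \<alpha>\<close> are unrelated modules: each has its own carrier, addition and scalar
  multiplication. Only the type of their elements is shared. The map \<open>j \<alpha> \<beta>\<close> goes from \<open>V \<beta>\<close>
  to \<open>V \<alpha>\<close> and is meaningful only for \<open>\<alpha> \<le> \<beta>\<close> and on the carrier of \<open>V \<beta>\<close>.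
\<close>

locale linear_injective_presheaf = field K
  for K :: "('k, 'r) ring_scheme" (structure) +
  fixes V :: "'i::order \<Rightarrow> ('k, 'v, 'm) module_scheme"
    and j :: "'i \<Rightarrow> 'i \<Rightarrow> 'v \<Rightarrow> 'v"
  assumes vectorspace_V: "\<And>\<alpha>. vectorspace K (V \<alpha>)"
    and linear_j: "\<And>\<alpha> \<beta>. \<alpha> \<le> \<beta> \<Longrightarrow> linear_map K (V \<beta>) (V \<alpha>) (j \<alpha> \<beta>)"
    and j_id: "\<And>\<alpha> x. x \<in> carrier (V \<alpha>) \<Longrightarrow> j \<alpha> \<alpha> x = x"
    and j_comp: "\<And>\<alpha> \<beta> \<gamma> x. \<alpha> \<le> \<beta> \<Longrightarrow> \<beta> \<le> \<gamma> \<Longrightarrow> x \<in> carrier (V \<gamma>) \<Longrightarrow>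
                   j \<alpha> \<beta> (j \<beta> \<gamma> x) = j \<alpha> \<gamma> x"
    and inj_j: "\<And>\<alpha> \<beta>. \<alpha> \<le> \<beta> \<Longrightarrow> inj_on (j \<alpha> \<beta>) (carrier (V \<beta>))"

definition presheaf_im ::
  "('i \<Rightarrow> ('k, 'v, 'm) module_scheme) \<Rightarrow> ('i \<Rightarrow> 'i \<Rightarrow> 'v \<Rightarrow> 'v) \<Rightarrow> 'i \<Rightarrow> 'i \<Rightarrow> 'v set"
  where "presheaf_im V j \<alpha> \<beta> = j \<alpha> \<beta> ` carrier (V \<beta>)"

text \<open>
  Sum of a possibly infinite family of subspaces of \<open>M\<close>; for \<open>I = {}\<close> it is the zero subspace.
\<close>

definition family_sum ::
  "('k, 'v, 'm) module_scheme \<Rightarrow> 'i set \<Rightarrow> ('i \<Rightarrow> 'v set) \<Rightarrow> 'v set"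
  where "family_sum M I W =
    {v. \<exists>F x. finite F \<and> F \<subseteq> I \<and> (\<forall>i\<in>F. x i \<in> W i) \<and> v = (\<Oplus>\<^bsub>M\<^esub>i\<in>F. x i)}"

text \<open>
  \<open>M\<close> is the internal direct sum of the subspaces \<open>W i\<close>. The family is indexed: distinct indices
  count as distinct summands even if the subspaces coincide.
\<close>

definition is_direct_sum ::
  "('k, 'v, 'm) module_scheme \<Rightarrow> 'i set \<Rightarrow> ('i \<Rightarrow> 'v set) \<Rightarrow> bool"
  where "is_direct_sum M I W \<longleftrightarrow>
    carrier M = family_sum M I W \<and>
    (\<forall>F x. finite F \<longrightarrow> F \<subseteq> I \<longrightarrow> (\<forall>i\<in>F. x i \<in> W i) \<longrightarrow> (\<Oplus>\<^bsub>M\<^esub>i\<in>F. x i) = \<zero>\<^bsub>M\<^esub> \<longrightarrow>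
       (\<forall>i\<in>F. x i = \<zero>\<^bsub>M\<^esub>))"

definition condition_G ::
  "('i::order \<Rightarrow> ('k, 'v, 'm) module_scheme) \<Rightarrow> ('i \<Rightarrow> 'i \<Rightarrow> 'v \<Rightarrow> 'v) \<Rightarrow> bool"
  where "condition_G V j \<longleftrightarrow>
    (\<forall>\<alpha> \<beta>. \<alpha> \<le> \<beta> \<longrightarrow>
       presheaf_im V j \<alpha> \<beta> \<inter> family_sum (V \<alpha>) {\<gamma>. \<alpha> < \<gamma> \<and> \<not> \<gamma> \<le> \<beta>} (presheaf_im V j \<alpha>)
         \<subseteq> family_sum (V \<alpha>) {\<gamma>. \<alpha> < \<gamma> \<and> \<beta> < \<gamma>} (presheaf_im V j \<alpha>))"

definition interaction_decomposition ::
  "('k, 'r) ring_scheme \<Rightarrow> ('i::order \<Rightarrow> ('k, 'v, 'm) module_scheme) \<Rightarrow>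
     ('i \<Rightarrow> 'i \<Rightarrow> 'v \<Rightarrow> 'v) \<Rightarrow> ('i \<Rightarrow> 'v set) \<Rightarrow> bool"
  where "interaction_decomposition K V j S \<longleftrightarrow>
    (\<forall>\<gamma>. subspace K (S \<gamma>) (V \<gamma>)) \<and>
    (\<forall>\<alpha>. is_direct_sum (V \<alpha>) {\<beta>. \<alpha> \<le> \<beta>} (\<lambda>\<beta>. j \<alpha> \<beta> ` S \<beta>))"

text \<open>
  For every \<open>\<alpha>\<close>: there is no infinite chain starting at \<open>\<alpha>\<close>, and the finite chains
  \<open>\<alpha> < \<beta>\<^sub>1 < \<dots> < \<beta>\<^sub>n\<close>, encoded as lists \<open>\<beta>s\<close>, have bounded length.
\<close>

definition locally_finite_dimension :: "'i::order itself \<Rightarrow> bool"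
  where "locally_finite_dimension _ \<longleftrightarrow>
    (\<forall>\<alpha>::'i.
       (\<nexists>c :: nat \<Rightarrow> 'i. c 0 = \<alpha> \<and> (\<forall>n. c n < c (Suc n))) \<and>
       (\<exists>N. \<forall>\<beta>s. successively (<) (\<alpha> # \<beta>s) \<longrightarrow> length \<beta>s \<le> N))"

end

theory Submission
  imports Defs
begin

text \<open>
  For (1), let \<open>S \<gamma>\<close> be a complement in \<open>V \<gamma>\<close> of the sum of the images of all \<open>V \<delta>\<close> with
  \<open>\<gamma> < \<delta>\<close>. Since there are no infinite ascending chains, well-founded induction shows that the
  images of the \<open>S \<beta>\<close> span \<open>V \<alpha>\<close>. In a nontrivial relation between them, choose a minimal
  index \<open>\<beta>\<close>: no other index \<open>\<gamma>\<close> satisfies \<open>\<gamma> \<le> \<beta>\<close>, so by (G) the component at \<open>\<beta>\<close> comes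
  from strictly above \<open>\<beta>\<close>, and by injectivity of \<open>j \<alpha> \<beta>\<close> and choice of \<open>S \<beta>\<close> it vanishes.
  For (2), an element of the left-hand side of (G) only has components at indices
  \<open>\<gamma> \<ge> \<beta>\<close>, and also only at indices \<open>\<gamma>\<close> with \<open>\<not> \<gamma> \<le> \<beta>\<close>; by uniqueness of the components,
  only those at \<open>\<gamma> > \<beta>\<close> remain.
\<close>

section \<open>Subspaces, sums and complements\<close>

context vectorspace
begin

section \<open>Closure of subspaces and existence of complements\<close>

lemma subspaceI:
  assumes "W \<subseteq> carrier V" "\<zero>\<^bsub>V\<^esub> \<in> W"
    and "\<And>v w. v \<in> W \<Longrightarrow> w \<in> W \<Longrightarrow> v \<oplus>\<^bsub>V\<^esub> w \<in> W"
    and "\<And>c v. c \<in> carrier K \<Longrightarrow> v \<in> W \<Longrightarrow> c \<odot>\<^bsub>V\<^esub> v \<in> W"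
  shows "subspace K W V"
  using assms by (intro subspace.intro submodule.intro vectorspace_axioms module_axioms) auto

lemma
  assumes "subspace K W V"
  shows subspace_carrier: "W \<subseteq> carrier V"
    and subspace_zero: "\<zero>\<^bsub>V\<^esub> \<in> W"
    and subspace_add: "\<And>v w. v \<in> W \<Longrightarrow> w \<in> W \<Longrightarrow> v \<oplus>\<^bsub>V\<^esub> w \<in> W"
    and subspace_smult: "\<And>c v. c \<in> carrier K \<Longrightarrow> v \<in> W \<Longrightarrow> c \<odot>\<^bsub>V\<^esub> v \<in> W"
proof -
  interpret submodule K W V
    using assms by simp
  show "W \<subseteq> carrier V" "\<zero>\<^bsub>V\<^esub> \<in> W" "\<And>v w. v \<in> W \<Longrightarrow> w \<in> W \<Longrightarrow> v \<oplus>\<^bsub>V\<^esub> w \<in> W"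
    "\<And>c v. c \<in> carrier K \<Longrightarrow> v \<in> W \<Longrightarrow> c \<odot>\<^bsub>V\<^esub> v \<in> W"
    using subset by auto
qed

lemma subspace_uminus:
  assumes "subspace K W V" "v \<in> W"
  shows "\<ominus>\<^bsub>V\<^esub> v \<in> W"
  using assms subspace_smult[OF assms(1), of "\<ominus>\<^bsub>K\<^esub> \<one>\<^bsub>K\<^esub>" v] subspace_carrier[OF assms(1)]
  by (auto simp: smult_minus_1)

lemma subspace_finsum:
  assumes W: "subspace K W V" and "\<And>i. i \<in> F \<Longrightarrow> x i \<in> W"
  shows "(\<Oplus>\<^bsub>V\<^esub>i\<in>F. x i) \<in> W"
  using assms(2)
\<comment> \<open>The induction also covers infinite \<open>F\<close>, where the sum is zero by
  convention.\<close>
proof (induction F rule: infinite_finite_induct)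
  case (insert a F)
  then have "(\<Oplus>\<^bsub>V\<^esub>i\<in>insert a F. x i) = x a \<oplus>\<^bsub>V\<^esub> (\<Oplus>\<^bsub>V\<^esub>i\<in>F. x i)"
    using subspace_carrier[OF W] by (intro finsum_insert) auto
  with insert show ?case
    using subspace_add[OF W] by simp
qed (use subspace_zero[OF W] in auto)

text \<open>By Zorn's lemma there is a subspace \<open>S\<close> maximal among those meeting
  \<open>W\<close> only in zero. If some \<open>x\<close> lay outside \<open>S + W\<close>,
  adjoining \<open>x\<close> to \<open>S\<close> would keep the intersection with \<open>W\<close>
  trivial, against maximality. The argument works in any dimension.\<close>

lemma subspace_complement_exists:
  assumes W: "subspace K W V"
  shows "\<exists>S. subspace K S V \<and> S \<inter> W = {\<zero>\<^bsub>V\<^esub>} \<and> subspace_sum S W = carrier V"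
proof -
  define \<A> where "\<A> = {S. subspace K S V \<and> S \<inter> W = {\<zero>\<^bsub>V\<^esub>}}"
  have "{\<zero>\<^bsub>V\<^esub>} \<in> \<A>"
    using subspace_zero[OF W] unfolding \<A>_def by (auto intro!: subspaceI)
  moreover have "\<Union>\<C> \<in> \<A>" if "\<C> \<noteq> {}" "subset.chain \<A> \<C>" for \<C>
  proof -
    have C: "subspace K X V" "X \<inter> W = {\<zero>\<^bsub>V\<^esub>}" if "X \<in> \<C>" for X
      using that \<open>subset.chain \<A> \<C>\<close> unfolding \<A>_def subset_chain_def by blast+
    \<comment> \<open>A union of subspaces is a subspace here because any two members of a chain lie
      in a common one, namely the larger.\<close>
    have "submodule K (\<Union>\<C>) V"
    proof (rule nested_union_vs[where I = \<C> and N = "\<lambda>X. X"])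
      show "submodule K X V" if "X \<in> \<C>" for X
        using C(1)[OF that] by simp
      show "\<exists>Z. Z \<in> \<C> \<and> X \<subseteq> Z \<and> Y \<subseteq> Z" if "X \<in> \<C>" "Y \<in> \<C>" for X Y
      proof -
        have "X \<subseteq> Y \<or> Y \<subseteq> X"
          using that \<open>subset.chain \<A> \<C>\<close> by (simp add: subset_chain_def)
        with that show ?thesis
          by blast
      qed
    qed (use \<open>\<C> \<noteq> {}\<close> in simp_all)
    then have "subspace K (\<Union>\<C>) V"
      by (intro subspace.intro vectorspace_axioms)
    moreover have "\<Union>\<C> \<inter> W = {\<zero>\<^bsub>V\<^esub>}"
      using C(2) \<open>\<C> \<noteq> {}\<close> by blast
    ultimately show ?thesis
      by (simp add: \<A>_def)
  qed
  ultimately obtain S where "S \<in> \<A>" and max: "\<And>X. X \<in> \<A> \<Longrightarrow> S \<subseteq> X \<Longrightarrow> X = S"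
    using subset_Zorn_nonempty[of \<A>] by blast
  then have S: "subspace K S V" and SW: "S \<inter> W = {\<zero>\<^bsub>V\<^esub>}"
    by (auto simp: \<A>_def)
  have sum: "subspace K (subspace_sum S W) V"
    using S W by (rule sum_is_subspace)
  have S_sub: "S \<subseteq> subspace_sum S W" and W_sub: "W \<subseteq> subspace_sum S W"
    using S W in_sum_vs vsum_comm by metis+
  have "x \<in> subspace_sum S W" if x: "x \<in> carrier V" for x
  proof (rule ccontr)
    assume nx: "x \<notin> subspace_sum S W"
    \<comment> \<open>\<open>T\<close> is \<open>S\<close> plus the line through \<open>x\<close>,
      the competitor that will contradict the maximality of \<open>S\<close>.\<close>
    define T where "T = {s \<oplus>\<^bsub>V\<^esub> k \<odot>\<^bsub>V\<^esub> x | s k. s \<in> S \<and> k \<in> carrier K}"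
    have Sc: "s \<in> carrier V" if "s \<in> S" for s
      using that subspace_carrier[OF S] by auto
    have "subspace K T V"
    proof (rule subspaceI)
      show "T \<subseteq> carrier V"
        using Sc x by (auto simp: T_def)
      have "\<zero>\<^bsub>V\<^esub> = \<zero>\<^bsub>V\<^esub> \<oplus>\<^bsub>V\<^esub> \<zero>\<^bsub>K\<^esub> \<odot>\<^bsub>V\<^esub> x"
        using x by simp
      then show "\<zero>\<^bsub>V\<^esub> \<in> T"
        unfolding T_def using subspace_zero[OF S] by blast
    next
      fix v w assume "v \<in> T" "w \<in> T"
      then obtain s k t l where *: "s \<in> S" "k \<in> carrier K" "t \<in> S" "l \<in> carrier K"
        "v = s \<oplus>\<^bsub>V\<^esub> k \<odot>\<^bsub>V\<^esub> x" "w = t \<oplus>\<^bsub>V\<^esub> l \<odot>\<^bsub>V\<^esub> x"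
        by (auto simp: T_def)
      then have "v \<oplus>\<^bsub>V\<^esub> w = (s \<oplus>\<^bsub>V\<^esub> t) \<oplus>\<^bsub>V\<^esub> (k \<oplus>\<^bsub>K\<^esub> l) \<odot>\<^bsub>V\<^esub> x"
        using x Sc by (simp add: smult_l_distr M.a_ac)
      then show "v \<oplus>\<^bsub>V\<^esub> w \<in> T"
        unfolding T_def using * subspace_add[OF S] by blast
    next
      fix c v assume c: "c \<in> carrier K" and "v \<in> T"
      then obtain s k where *: "s \<in> S" "k \<in> carrier K" "v = s \<oplus>\<^bsub>V\<^esub> k \<odot>\<^bsub>V\<^esub> x"
        by (auto simp: T_def)
      then have "c \<odot>\<^bsub>V\<^esub> v = c \<odot>\<^bsub>V\<^esub> s \<oplus>\<^bsub>V\<^esub> (c \<otimes>\<^bsub>K\<^esub> k) \<odot>\<^bsub>V\<^esub> x"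
        using c x Sc by (simp add: smult_r_distr smult_assoc1)
      then show "c \<odot>\<^bsub>V\<^esub> v \<in> T"
        unfolding T_def using * c subspace_smult[OF S] by blast
    qed
    moreover have "T \<inter> W = {\<zero>\<^bsub>V\<^esub>}"
    proof (intro equalityI subsetI)
      fix w assume "w \<in> T \<inter> W"
      then obtain s k where *: "s \<in> S" "k \<in> carrier K" "w = s \<oplus>\<^bsub>V\<^esub> k \<odot>\<^bsub>V\<^esub> x" "w \<in> W"
        by (auto simp: T_def)
      \<comment> \<open>For nonzero \<open>k\<close>, the vector \<open>k x = w - s\<close> lies in
        \<open>S + W\<close>, and dividing by \<open>k\<close> would put \<open>x\<close> itself
        there.\<close>
      have "k = \<zero>\<^bsub>K\<^esub>"
      proof (rule ccontr)
        assume "k \<noteq> \<zero>\<^bsub>K\<^esub>"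
        then have k: "inv\<^bsub>K\<^esub> k \<in> carrier K" "inv\<^bsub>K\<^esub> k \<otimes>\<^bsub>K\<^esub> k = \<one>\<^bsub>K\<^esub>"
          using * field_Units by auto
        have "k \<odot>\<^bsub>V\<^esub> x = \<ominus>\<^bsub>V\<^esub> s \<oplus>\<^bsub>V\<^esub> w"
          using * x Sc by (simp add: M.r_neg1)
        then have "k \<odot>\<^bsub>V\<^esub> x \<in> subspace_sum S W"
          using *(1,4) S_sub W_sub subspace_add[OF sum] subspace_uminus[OF sum] by (metis subsetD)
        then have "inv\<^bsub>K\<^esub> k \<odot>\<^bsub>V\<^esub> (k \<odot>\<^bsub>V\<^esub> x) \<in> subspace_sum S W"
          using k subspace_smult[OF sum] by blast
        with nx k * x show False
          by (simp flip: smult_assoc1)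
      qed
      with * x Sc have "w \<in> S"
        by simp
      with * SW show "w \<in> {\<zero>\<^bsub>V\<^esub>}"
        by auto
    qed (use \<open>subspace K T V\<close> W subspace_zero in auto)
    ultimately have "T \<in> \<A>"
      by (simp add: \<A>_def)
    moreover have "S \<subseteq> T"
    proof
      fix s assume "s \<in> S"
      moreover from this have "s = s \<oplus>\<^bsub>V\<^esub> \<zero>\<^bsub>K\<^esub> \<odot>\<^bsub>V\<^esub> x"
        using x Sc by simp
      ultimately show "s \<in> T"
        unfolding T_def by blast
    qed
    ultimately have "T = S"
      by (rule max)
    moreover have "x = \<zero>\<^bsub>V\<^esub> \<oplus>\<^bsub>V\<^esub> \<one>\<^bsub>K\<^esub> \<odot>\<^bsub>V\<^esub> x"
      using x by simp
    then have "x \<in> T"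
      unfolding T_def using subspace_zero[OF S] by blast
    ultimately show False
      using nx S_sub by blast
  qed
  then show ?thesis
    using S SW subspace_carrier[OF sum] by blast
qed

section \<open>Sums of families of subspaces\<close>

lemma family_sumI:
  assumes "finite F" "F \<subseteq> I" "\<And>i. i \<in> F \<Longrightarrow> x i \<in> W i"
  shows "(\<Oplus>\<^bsub>V\<^esub>i\<in>F. x i) \<in> family_sum V I W"
  unfolding family_sum_def using assms by blast

lemma family_sumE:
  assumes "v \<in> family_sum V I W"
  obtains F x where "finite F" "F \<subseteq> I" "\<forall>i\<in>F. x i \<in> W i" "v = (\<Oplus>\<^bsub>V\<^esub>i\<in>F. x i)"
  using assms unfolding family_sum_def by blast

text \<open>With \<open>family_sum_upper\<close> and \<open>family_sum_subspace\<close> this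
  characterises the sum as the least subspace containing all summands, so that most later inclusions
  can be checked summand by summand.\<close>

lemma family_sum_least:
  assumes "subspace K N V" "\<And>i. i \<in> I \<Longrightarrow> W i \<subseteq> N"
  shows "family_sum V I W \<subseteq> N"
  using assms by (blast elim: family_sumE intro: subspace_finsum)

lemma family_sum_mono:
  assumes "I \<subseteq> J" "\<And>i. i \<in> I \<Longrightarrow> W i \<subseteq> U i"
  shows "family_sum V I W \<subseteq> family_sum V J U"
  using assms by (blast elim: family_sumE intro: family_sumI)

lemma family_sum_upper:
  assumes "i \<in> I" "W i \<subseteq> carrier V"
  shows "W i \<subseteq> family_sum V I W"
proof
  fix v assume "v \<in> W i"
  moreover have "(\<Oplus>\<^bsub>V\<^esub>k\<in>{i}. v) = v"
    using \<open>v \<in> W i\<close> assms by (subst finsum_insert) auto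
  ultimately show "v \<in> family_sum V I W"
    using family_sumI[of "{i}" I "\<lambda>_. v" W] assms by auto
qed

text \<open>Padding by zero puts two finite sums with different supports on a common index set,
  where they can be added or compared componentwise.\<close>

lemma finsum_extend_zero:
  assumes "finite G" "F \<subseteq> G" "\<And>i. i \<in> F \<Longrightarrow> x i \<in> carrier V"
  shows "(\<Oplus>\<^bsub>V\<^esub>i\<in>F. x i) = (\<Oplus>\<^bsub>V\<^esub>i\<in>G. if i \<in> F then x i else \<zero>\<^bsub>V\<^esub>)"
  using assms by (intro M.add.finprod_mono_neutral_cong_left) auto

lemma family_sum_subspace:
  assumes W: "\<And>i. i \<in> I \<Longrightarrow> subspace K (W i) V"
  shows "subspace K (family_sum V I W) V"
proof (rule subspaceI)
  have Wc: "x \<in> carrier V" if "x \<in> W i" "i \<in> I" for x i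
    using that subspace_carrier[OF W] by auto
  have "subspace K (carrier V) V"
    by (rule subspaceI) auto
  then show "family_sum V I W \<subseteq> carrier V"
    using Wc by (intro family_sum_least) auto
  show "\<zero>\<^bsub>V\<^esub> \<in> family_sum V I W"
    using family_sumI[of "{}" I _ W] by simp
  show "v \<oplus>\<^bsub>V\<^esub> w \<in> family_sum V I W" if vw: "v \<in> family_sum V I W" "w \<in> family_sum V I W" for v w
  proof -
    from vw(1) obtain F x where F: "finite F" "F \<subseteq> I" "\<forall>i\<in>F. x i \<in> W i"
      "v = (\<Oplus>\<^bsub>V\<^esub>i\<in>F. x i)"
      by (rule family_sumE)
    from vw(2) obtain G y where G: "finite G" "G \<subseteq> I" "\<forall>i\<in>G. y i \<in> W i"
      "w = (\<Oplus>\<^bsub>V\<^esub>i\<in>G. y i)"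
      by (rule family_sumE)
    define x' where "x' = (\<lambda>i. if i \<in> F then x i else \<zero>\<^bsub>V\<^esub>)"
    define y' where "y' = (\<lambda>i. if i \<in> G then y i else \<zero>\<^bsub>V\<^esub>)"
    have mem: "x' i \<in> W i" "y' i \<in> W i" if "i \<in> F \<union> G" for i
      using that F G subspace_zero[OF W] by (auto simp: x'_def y'_def)
    have "v = (\<Oplus>\<^bsub>V\<^esub>i\<in>F \<union> G. x' i)" "w = (\<Oplus>\<^bsub>V\<^esub>i\<in>F \<union> G. y' i)"
      unfolding x'_def y'_def F(4) G(4) using F(1-3) G(1-3) Wc
      by (intro finsum_extend_zero; blast)+
    moreover have "x' \<in> F \<union> G \<rightarrow> carrier V" "y' \<in> F \<union> G \<rightarrow> carrier V"
      using mem Wc F(2) G(2) by blast+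
    ultimately have "v \<oplus>\<^bsub>V\<^esub> w = (\<Oplus>\<^bsub>V\<^esub>i\<in>F \<union> G. x' i \<oplus>\<^bsub>V\<^esub> y' i)"
      by (simp add: finsum_addf)
    then show ?thesis
      using F(1,2) G(1,2) mem subspace_add[OF W] by (auto intro!: family_sumI)
  qed
  show "c \<odot>\<^bsub>V\<^esub> v \<in> family_sum V I W" if c: "c \<in> carrier K" and v: "v \<in> family_sum V I W" for c v
  proof -
    from v obtain F x where F: "finite F" "F \<subseteq> I" "\<forall>i\<in>F. x i \<in> W i"
      "v = (\<Oplus>\<^bsub>V\<^esub>i\<in>F. x i)"
      by (rule family_sumE)
    moreover from this have "x \<in> F \<rightarrow> carrier V"
      using Wc by blast
    ultimately have "c \<odot>\<^bsub>V\<^esub> v = (\<Oplus>\<^bsub>V\<^esub>i\<in>F. c \<odot>\<^bsub>V\<^esub> x i)"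
      using c by (simp add: finsum_smult)
    then show ?thesis
      using F c subspace_smult[OF W] by (auto intro!: family_sumI)
  qed
qed

text \<open>A common element has one expansion supported in \<open>A\<close> and one in
  \<open>B\<close>. Uniqueness of components makes them agree after padding by zero, so the first
  one vanishes outside \<open>B\<close>.\<close>

lemma direct_sum_inter:
  assumes W: "\<And>i. i \<in> I \<Longrightarrow> subspace K (W i) V" and dir: "is_direct_sum V I W"
    and "A \<subseteq> I" "B \<subseteq> I"
  shows "family_sum V A W \<inter> family_sum V B W \<subseteq> family_sum V (A \<inter> B) W"
proof
  have Wc: "x \<in> carrier V" if "x \<in> W i" "i \<in> I" for x i
    using that subspace_carrier[OF W] by auto
  fix v assume "v \<in> family_sum V A W \<inter> family_sum V B W"
  then have v: "v \<in> family_sum V A W" "v \<in> family_sum V B W"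
    by simp_all
  from v(1) obtain F x where F: "finite F" "F \<subseteq> A" "\<forall>i\<in>F. x i \<in> W i" "v = (\<Oplus>\<^bsub>V\<^esub>i\<in>F. x i)"
    by (rule family_sumE)
  from v(2) obtain G y where G: "finite G" "G \<subseteq> B" "\<forall>i\<in>G. y i \<in> W i"
    "v = (\<Oplus>\<^bsub>V\<^esub>i\<in>G. y i)"
    by (rule family_sumE)
  define x' where "x' = (\<lambda>i. if i \<in> F then x i else \<zero>\<^bsub>V\<^esub>)"
  define y' where "y' = (\<lambda>i. if i \<in> G then y i else \<zero>\<^bsub>V\<^esub>)"
  have FG: "finite (F \<union> G)" "F \<union> G \<subseteq> I"
    using F(1,2) G(1,2) assms(3,4) by auto
  have mem: "x' i \<in> W i" "y' i \<in> W i" if "i \<in> F \<union> G" for i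
    using that F G FG subspace_zero[OF W] by (auto simp: x'_def y'_def)
  have carr: "x' i \<in> carrier V" "y' i \<in> carrier V" if "i \<in> F \<union> G" for i
    using mem[OF that] Wc that FG by blast+
  have vx: "v = (\<Oplus>\<^bsub>V\<^esub>i\<in>F \<union> G. x' i)"
    unfolding x'_def F(4) using F(2,3) Wc assms(3) FG(1) by (intro finsum_extend_zero) blast+
  have vy: "v = (\<Oplus>\<^bsub>V\<^esub>i\<in>F \<union> G. y' i)"
    unfolding y'_def G(4) using G(2,3) Wc assms(4) FG(1) by (intro finsum_extend_zero) blast+
  \<comment> \<open>The sum of the negated \<open>y' i\<close> is added to \<open>v\<close> twice:
    with \<open>v\<close> expanded by \<open>y'\<close> the result is zero, with \<open>v\<close>
    expanded by \<open>x'\<close> it is the sum of the differences. Hence these differences sum to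
    zero.\<close>
  have "(\<Oplus>\<^bsub>V\<^esub>i\<in>F \<union> G. \<ominus>\<^bsub>V\<^esub> y' i) \<oplus>\<^bsub>V\<^esub> v = (\<Oplus>\<^bsub>V\<^esub>i\<in>F \<union> G. \<ominus>\<^bsub>V\<^esub> y' i \<oplus>\<^bsub>V\<^esub> y' i)"
    unfolding vy using carr by (subst finsum_addf) auto
  also have "\<dots> = \<zero>\<^bsub>V\<^esub>"
    using carr by (intro finsum_all0) (simp add: M.l_neg)
  finally have "(\<Oplus>\<^bsub>V\<^esub>i\<in>F \<union> G. \<ominus>\<^bsub>V\<^esub> y' i \<oplus>\<^bsub>V\<^esub> x' i) = \<zero>\<^bsub>V\<^esub>"
    unfolding vx using carr by (subst finsum_addf) auto
  moreover have "\<ominus>\<^bsub>V\<^esub> y' i \<oplus>\<^bsub>V\<^esub> x' i \<in> W i" if "i \<in> F \<union> G" for i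
  proof -
    have "subspace K (W i) V"
      using that FG W by blast
    then show ?thesis
      using mem[OF that] subspace_add subspace_uminus by blast
  qed
  ultimately have zero: "\<ominus>\<^bsub>V\<^esub> y' i \<oplus>\<^bsub>V\<^esub> x' i = \<zero>\<^bsub>V\<^esub>" if "i \<in> F \<union> G" for i
    using that dir FG unfolding is_direct_sum_def by meson
  have "x' i = y' i" if "i \<in> F \<union> G" for i
    using zero[OF that] carr[OF that] by (metis M.add.inv_closed M.minus_equality M.minus_minus)
  \<comment> \<open>Outside \<open>G\<close> the padded family \<open>y'\<close> takes its default
    value zero.\<close>
  then have "x' i = \<zero>\<^bsub>V\<^esub>" if "i \<in> F - F \<inter> G" for i
    using that by (auto simp: y'_def)
  moreover have "x i \<in> carrier V" if "i \<in> F" for i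
    using that F(2,3) Wc assms(3) by blast
  ultimately have "(\<Oplus>\<^bsub>V\<^esub>i\<in>F \<inter> G. x i) = (\<Oplus>\<^bsub>V\<^esub>i\<in>F. x i)"
    using F(1) by (intro M.add.finprod_mono_neutral_cong_left) (auto simp: x'_def)
  moreover have "(\<Oplus>\<^bsub>V\<^esub>i\<in>F \<inter> G. x i) \<in> family_sum V (A \<inter> B) W"
    using F(1-3) G(2) by (intro family_sumI) auto
  ultimately show "v \<in> family_sum V (A \<inter> B) W"
    using F(4) by simp
qed

end

section \<open>Images and preimages of subspaces under linear maps\<close>

context linear_map
begin

lemma image_subspace:
  assumes "subspace K N V"
  shows "subspace K (T ` N) W"
proof (rule W.subspaceI)
  note N = V.subspace_carrier[OF assms]
  show "T ` N \<subseteq> carrier W"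
    using N by auto
  show "\<zero>\<^bsub>W\<^esub> \<in> T ` N"
    using V.subspace_zero[OF assms] T0_is_0 by (metis imageI)
  show "v \<oplus>\<^bsub>W\<^esub> w \<in> T ` N" if "v \<in> T ` N" "w \<in> T ` N" for v w
  proof -
    from that obtain a b where ab: "a \<in> N" "b \<in> N" "v = T a" "w = T b"
      by blast
    then have "v \<oplus>\<^bsub>W\<^esub> w = T (a \<oplus>\<^bsub>V\<^esub> b)"
      using N T_add[of a b] by (simp add: subset_iff)
    then show ?thesis
      using ab V.subspace_add[OF assms] by blast
  qed
  show "c \<odot>\<^bsub>W\<^esub> v \<in> T ` N" if c: "c \<in> carrier K" and "v \<in> T ` N" for c v
  proof -
    from that obtain a where a: "a \<in> N" "v = T a"
      by blast
    then have "c \<odot>\<^bsub>W\<^esub> v = T (c \<odot>\<^bsub>V\<^esub> a)"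
      using c N T_smult[of c a] by (simp add: subset_iff)
    then show ?thesis
      using a c V.subspace_smult[OF assms] by blast
  qed
qed

lemma vimage_subspace:
  assumes "subspace K N W"
  shows "subspace K {v \<in> carrier V. T v \<in> N} V"
  using W.subspace_zero[OF assms] W.subspace_add[OF assms] W.subspace_smult[OF assms]
  by (intro V.subspaceI) auto

end

section \<open>Interaction decompositions\<close>

context linear_injective_presheaf
begin

lemma image_subspace:
  assumes "\<alpha> \<le> \<beta>" "subspace K N (V \<beta>)"
  shows "subspace K (j \<alpha> \<beta> ` N) (V \<alpha>)"
  using linear_map.image_subspace[OF linear_j] assms .

lemma presheaf_im_subspace:
  assumes "\<alpha> \<le> \<beta>"
  shows "subspace K (presheaf_im V j \<alpha> \<beta>) (V \<alpha>)"
proof -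
  interpret \<beta>: vectorspace K "V \<beta>"
    by (rule vectorspace_V)
  have "subspace K (carrier (V \<beta>)) (V \<beta>)"
    by (rule \<beta>.subspaceI) auto
  then show ?thesis
    unfolding presheaf_im_def by (rule image_subspace[OF assms])
qed

text \<open>Functoriality: what comes from \<gamma> reaches \<alpha> through \<beta>. This lets the
  right-hand side of (G) be pulled back to \<beta>.\<close>

lemma presheaf_im_comp:
  assumes "\<alpha> \<le> \<beta>" "\<beta> \<le> \<gamma>"
  shows "presheaf_im V j \<alpha> \<gamma> = j \<alpha> \<beta> ` presheaf_im V j \<beta> \<gamma>"
  using j_comp[OF assms] by (force simp: presheaf_im_def image_image)

lemma image_subset_presheaf_im:
  assumes "subspace K N (V \<beta>)"
  shows "j \<alpha> \<beta> ` N \<subseteq> presheaf_im V j \<alpha> \<beta>"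
  using vectorspace.subspace_carrier[OF vectorspace_V assms] by (auto simp: presheaf_im_def)

text \<open>Applying \<open>j \<alpha> \<beta>\<close> to a spanning family of
  \<open>V \<beta>\<close> gives one of the image in \<open>V \<alpha>\<close>, since
  \<open>j\<close> is compatible with composition. The index set \<open>I\<close> is left free
  because the applications use the indices above \<beta>, those not below \<beta> for another
  \<beta>, and all those above \<alpha>.\<close>

lemma presheaf_im_subset_family_sum:
  assumes S: "\<And>\<delta>. subspace K (S \<delta>) (V \<delta>)"
    and span: "carrier (V \<beta>) \<subseteq> family_sum (V \<beta>) {\<delta>. \<beta> \<le> \<delta>} (\<lambda>\<delta>. j \<beta> \<delta> ` S \<delta>)"
    and "\<alpha> \<le> \<beta>" "{\<delta>. \<beta> \<le> \<delta>} \<subseteq> I" "I \<subseteq> {\<delta>. \<alpha> \<le> \<delta>}"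
  shows "presheaf_im V j \<alpha> \<beta> \<subseteq> family_sum (V \<alpha>) I (\<lambda>\<delta>. j \<alpha> \<delta> ` S \<delta>)"
proof -
  interpret j: linear_map K "V \<beta>" "V \<alpha>" "j \<alpha> \<beta>"
    using \<open>\<alpha> \<le> \<beta>\<close> by (rule linear_j)
  let ?W = "\<lambda>\<delta>. j \<alpha> \<delta> ` S \<delta>"
  \<comment> \<open>\<open>?N\<close> is the preimage of the target sum. Being a subspace, it
    contains the whole sum in \<open>V \<beta>\<close> once it contains each summand.\<close>
  let ?N = "{v \<in> carrier (V \<beta>). j \<alpha> \<beta> v \<in> family_sum (V \<alpha>) I ?W}"
  have W: "subspace K (?W \<delta>) (V \<alpha>)" if "\<delta> \<in> I" for \<delta>
    using that assms(5) S by (intro image_subspace) auto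
  have "subspace K ?N (V \<beta>)"
    using W by (intro j.vimage_subspace j.W.family_sum_subspace)
  moreover have "j \<beta> \<delta> ` S \<delta> \<subseteq> ?N" if "\<beta> \<le> \<delta>" for \<delta>
  proof -
    have "S \<delta> \<subseteq> carrier (V \<delta>)"
      by (rule vectorspace.subspace_carrier[OF vectorspace_V S])
    then have "j \<alpha> \<beta> ` j \<beta> \<delta> ` S \<delta> = ?W \<delta>"
      using j_comp[OF \<open>\<alpha> \<le> \<beta>\<close> that] by (force simp: image_image)
    moreover have "j \<beta> \<delta> ` S \<delta> \<subseteq> carrier (V \<beta>)"
      by (rule vectorspace.subspace_carrier[OF vectorspace_V image_subspace[OF that S]])
    moreover have "?W \<delta> \<subseteq> family_sum (V \<alpha>) I ?W"
      using that assms(4) j.W.subspace_carrier[OF W] by (intro j.W.family_sum_upper) auto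
    ultimately show ?thesis
      by blast
  qed
  ultimately have "family_sum (V \<beta>) {\<delta>. \<beta> \<le> \<delta>} (\<lambda>\<delta>. j \<beta> \<delta> ` S \<delta>) \<subseteq> ?N"
    by (intro j.V.family_sum_least) auto
  with span show ?thesis
    by (auto simp: presheaf_im_def)
qed

lemma decomposition_imp_condition_G:
  assumes "interaction_decomposition K V j S"
  shows "condition_G V j"
  unfolding condition_G_def
proof (intro allI impI)
  fix \<alpha> \<beta> :: 'i
  assume "\<alpha> \<le> \<beta>"
  interpret \<alpha>: vectorspace K "V \<alpha>"
    by (rule vectorspace_V)
  have S: "subspace K (S \<gamma>) (V \<gamma>)" and dir: "is_direct_sum (V \<gamma>) {\<delta>. \<gamma> \<le> \<delta>} (\<lambda>\<delta>. j \<gamma> \<delta> ` S \<delta>)"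
    for \<gamma>
    using assms unfolding interaction_decomposition_def by blast+
  let ?W = "\<lambda>\<gamma>. j \<alpha> \<gamma> ` S \<gamma>" and ?B = "{\<gamma>. \<alpha> \<le> \<gamma> \<and> \<not> \<gamma> \<le> \<beta>}"
  have W: "subspace K (?W \<gamma>) (V \<alpha>)" if "\<alpha> \<le> \<gamma>" for \<gamma>
    using that S by (rule image_subspace)
  have im: "presheaf_im V j \<alpha> \<gamma> \<subseteq> family_sum (V \<alpha>) I ?W"
    if "\<alpha> \<le> \<gamma>" "{\<delta>. \<gamma> \<le> \<delta>} \<subseteq> I" "I \<subseteq> {\<delta>. \<alpha> \<le> \<delta>}" for \<gamma> I
    using that S dir[of \<gamma>] by (intro presheaf_im_subset_family_sum) (auto simp: is_direct_sum_def)
  have "presheaf_im V j \<alpha> \<beta> \<subseteq> family_sum (V \<alpha>) {\<gamma>. \<beta> \<le> \<gamma>} ?W"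
    using \<open>\<alpha> \<le> \<beta>\<close> by (intro im) auto
  \<comment> \<open>\<open>im\<close> applies with index set \<open>?B\<close> because
    \<open>?B\<close> is closed upwards: from \<open>\<gamma> \<le> \<delta>\<close> and
    \<open>\<delta> \<le> \<beta>\<close> it would follow that
    \<open>\<gamma> \<le> \<beta>\<close>.\<close>
  moreover have "family_sum (V \<alpha>) {\<gamma>. \<alpha> < \<gamma> \<and> \<not> \<gamma> \<le> \<beta>} (presheaf_im V j \<alpha>) \<subseteq> family_sum (V \<alpha>) ?B ?W"
    using W by (intro \<alpha>.family_sum_least \<alpha>.family_sum_subspace im) auto
  moreover have "family_sum (V \<alpha>) {\<gamma>. \<beta> \<le> \<gamma>} ?W \<inter> family_sum (V \<alpha>) ?B ?W
      \<subseteq> family_sum (V \<alpha>) ({\<gamma>. \<beta> \<le> \<gamma>} \<inter> ?B) ?W"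
    using \<open>\<alpha> \<le> \<beta>\<close> W dir by (intro \<alpha>.direct_sum_inter[of "{\<gamma>. \<alpha> \<le> \<gamma>}"]) auto
  \<comment> \<open>On the intersection, \<open>\<beta> \<le> \<gamma>\<close> and
    \<open>\<not> \<gamma> \<le> \<beta>\<close> give \<open>\<beta> < \<gamma>\<close>, hence also
    \<open>\<alpha> < \<gamma>\<close>.\<close>
  moreover have "family_sum (V \<alpha>) ({\<gamma>. \<beta> \<le> \<gamma>} \<inter> ?B) ?W
      \<subseteq> family_sum (V \<alpha>) {\<gamma>. \<alpha> < \<gamma> \<and> \<beta> < \<gamma>} (presheaf_im V j \<alpha>)"
    using \<open>\<alpha> \<le> \<beta>\<close> S by (intro \<alpha>.family_sum_mono image_subset_presheaf_im) auto
  ultimately show "presheaf_im V j \<alpha> \<beta>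
      \<inter> family_sum (V \<alpha>) {\<gamma>. \<alpha> < \<gamma> \<and> \<not> \<gamma> \<le> \<beta>} (presheaf_im V j \<alpha>)
      \<subseteq> family_sum (V \<alpha>) {\<gamma>. \<alpha> < \<gamma> \<and> \<beta> < \<gamma>} (presheaf_im V j \<alpha>)"
    by blast
qed

lemma condition_G_imp_decomposition:
  assumes G: "condition_G V j" and wf: "wf {(\<beta>, \<alpha> :: 'i). \<alpha> < \<beta>}"
  shows "\<exists>S. interaction_decomposition K V j S"
proof -
  \<comment> \<open>\<open>P \<gamma>\<close> is the part of \<open>V \<gamma>\<close> coming from
    strictly above \<gamma>. The complements \<open>S \<gamma>\<close> are chosen independently of
    one another.\<close>
  define P where "P \<gamma> = family_sum (V \<gamma>) {\<delta>. \<gamma> < \<delta>} (presheaf_im V j \<gamma>)" for \<gamma>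
  have P: "subspace K (P \<gamma>) (V \<gamma>)" for \<gamma>
    unfolding P_def by (intro vectorspace.family_sum_subspace vectorspace_V presheaf_im_subspace) auto
  have "\<exists>S. \<forall>\<gamma>. subspace K (S \<gamma>) (V \<gamma>) \<and> S \<gamma> \<inter> P \<gamma> = {\<zero>\<^bsub>V \<gamma>\<^esub>} \<and>
      module.submodule_sum (V \<gamma>) (S \<gamma>) (P \<gamma>) = carrier (V \<gamma>)"
    using vectorspace.subspace_complement_exists[OF vectorspace_V P] by (intro choice allI)
  then obtain S where S: "\<And>\<gamma>. subspace K (S \<gamma>) (V \<gamma>)"
    and SP: "\<And>\<gamma>. S \<gamma> \<inter> P \<gamma> = {\<zero>\<^bsub>V \<gamma>\<^esub>}"
    and SP_sum: "\<And>\<gamma>. module.submodule_sum (V \<gamma>) (S \<gamma>) (P \<gamma>) = carrier (V \<gamma>)"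
    by blast
  have W: "subspace K (j \<alpha> \<gamma> ` S \<gamma>) (V \<alpha>)" if "\<alpha> \<le> \<gamma>" for \<alpha> \<gamma>
    using that S by (rule image_subspace)
  have span: "carrier (V \<alpha>) \<subseteq> family_sum (V \<alpha>) {\<beta>. \<alpha> \<le> \<beta>} (\<lambda>\<beta>. j \<alpha> \<beta> ` S \<beta>)" for \<alpha>
    using wf
  \<comment> \<open>The relation is the reversed strict order, so the induction hypothesis is
    available at all indices strictly above \<alpha>.\<close>
  proof (induction \<alpha> rule: wf_induct_rule)
    case (less \<alpha>)
    interpret \<alpha>: vectorspace K "V \<alpha>"
      by (rule vectorspace_V)
    let ?N = "family_sum (V \<alpha>) {\<beta>. \<alpha> \<le> \<beta>} (\<lambda>\<beta>. j \<alpha> \<beta> ` S \<beta>)"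
    have N: "subspace K ?N (V \<alpha>)"
      using W by (intro \<alpha>.family_sum_subspace) auto
    \<comment> \<open>The summand at index \<alpha> is \<open>S \<alpha>\<close> itself;
      \<open>P \<alpha>\<close> is covered by the induction hypothesis, and the two together span
      \<open>V \<alpha>\<close>.\<close>
    have "j \<alpha> \<alpha> ` S \<alpha> = S \<alpha>"
      using \<alpha>.subspace_carrier[OF S] by (simp add: j_id subset_iff cong: image_cong_simp)
    then have "S \<alpha> \<subseteq> ?N"
      using \<alpha>.family_sum_upper[of \<alpha> "{\<beta>. \<alpha> \<le> \<beta>}" "\<lambda>\<beta>. j \<alpha> \<beta> ` S \<beta>"] \<alpha>.subspace_carrier[OF S] by simp
    moreover have "P \<alpha> \<subseteq> ?N"
      unfolding P_def using N less S
      by (intro \<alpha>.family_sum_least presheaf_im_subset_family_sum) auto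
    ultimately show ?case
      using \<alpha>.vsum_is_minimal[OF S P N] SP_sum by simp
  qed
  have "is_direct_sum (V \<alpha>) {\<beta>. \<alpha> \<le> \<beta>} (\<lambda>\<beta>. j \<alpha> \<beta> ` S \<beta>)" for \<alpha>
  proof -
    interpret \<alpha>: vectorspace K "V \<alpha>"
      by (rule vectorspace_V)
    let ?W = "\<lambda>\<gamma>. j \<alpha> \<gamma> ` S \<gamma>"
    have "family_sum (V \<alpha>) {\<beta>. \<alpha> \<le> \<beta>} ?W \<subseteq> carrier (V \<alpha>)"
      using W by (intro \<alpha>.subspace_carrier \<alpha>.family_sum_subspace) auto
    moreover have "\<forall>i\<in>F. x i = \<zero>\<^bsub>V \<alpha>\<^esub>"
      if F: "finite F" "F \<subseteq> {\<beta>. \<alpha> \<le> \<beta>}" and x: "\<forall>i\<in>F. x i \<in> ?W i"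
        and zero: "(\<Oplus>\<^bsub>V \<alpha>\<^esub>i\<in>F. x i) = \<zero>\<^bsub>V \<alpha>\<^esub>" for F x
    proof (rule ccontr)
      assume "\<not> (\<forall>i\<in>F. x i = \<zero>\<^bsub>V \<alpha>\<^esub>)"
      \<comment> \<open>The support of the relation is finite and nonempty, so it has a minimal
        element even if the poset has none.\<close>
      define E where "E = {i \<in> F. x i \<noteq> \<zero>\<^bsub>V \<alpha>\<^esub>}"
      have "finite E" "E \<noteq> {}"
        using F \<open>\<not> (\<forall>i\<in>F. x i = \<zero>\<^bsub>V \<alpha>\<^esub>)\<close> by (auto simp: E_def)
      then obtain \<beta> where "\<beta> \<in> E" and min: "\<And>\<gamma>. \<gamma> \<in> E \<Longrightarrow> \<gamma> \<le> \<beta> \<Longrightarrow> \<gamma> = \<beta>"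
        using finite_has_minimal by metis
      then have "\<alpha> \<le> \<beta>" "x \<beta> \<in> ?W \<beta>" and nz: "x \<beta> \<noteq> \<zero>\<^bsub>V \<alpha>\<^esub>"
        using F x by (auto simp: E_def)
      have xc: "x i \<in> carrier (V \<alpha>)" if "i \<in> F" for i
        using that F x \<alpha>.subspace_carrier[OF W] by blast
      have Im: "subspace K (family_sum (V \<alpha>) {\<gamma>. \<alpha> < \<gamma> \<and> \<not> \<gamma> \<le> \<beta>} (presheaf_im V j \<alpha>)) (V \<alpha>)"
        by (intro \<alpha>.family_sum_subspace presheaf_im_subspace) auto
      let ?r = "\<Oplus>\<^bsub>V \<alpha>\<^esub>i\<in>E - {\<beta>}. x i"
      have "(\<Oplus>\<^bsub>V \<alpha>\<^esub>i\<in>F. x i) = (\<Oplus>\<^bsub>V \<alpha>\<^esub>i\<in>E. x i)"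
        using F xc by (intro \<alpha>.M.add.finprod_mono_neutral_cong_right) (auto simp: E_def)
      also have "\<dots> = (\<Oplus>\<^bsub>V \<alpha>\<^esub>i\<in>insert \<beta> (E - {\<beta>}). x i)"
        using \<open>\<beta> \<in> E\<close> by (simp add: insert_absorb)
      also have "\<dots> = x \<beta> \<oplus>\<^bsub>V \<alpha>\<^esub> ?r"
        using \<open>finite E\<close> \<open>\<beta> \<in> E\<close> xc by (intro \<alpha>.M.finsum_insert) (auto simp: E_def)
      finally have "x \<beta> = \<ominus>\<^bsub>V \<alpha>\<^esub> ?r"
        using zero xc \<open>\<beta> \<in> E\<close> by (intro \<alpha>.M.minus_equality[symmetric] \<alpha>.M.finsum_closed) (auto simp: E_def)
      moreover have "?r \<in> family_sum (V \<alpha>) {\<gamma>. \<alpha> < \<gamma> \<and> \<not> \<gamma> \<le> \<beta>} (presheaf_im V j \<alpha>)"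
      proof (rule \<alpha>.family_sumI)
        \<comment> \<open>The inequality \<open>\<alpha> < \<gamma>\<close> is strict because
          \<open>\<gamma> = \<alpha>\<close> would give
          \<open>\<gamma> \<le> \<beta>\<close>.\<close>
        show "E - {\<beta>} \<subseteq> {\<gamma>. \<alpha> < \<gamma> \<and> \<not> \<gamma> \<le> \<beta>}"
        proof
          fix \<gamma> assume \<gamma>: "\<gamma> \<in> E - {\<beta>}"
          then have "\<not> \<gamma> \<le> \<beta>"
            using min by blast
          moreover have "\<alpha> \<le> \<gamma>"
            using \<gamma> F by (auto simp: E_def)
          ultimately show "\<gamma> \<in> {\<gamma>. \<alpha> < \<gamma> \<and> \<not> \<gamma> \<le> \<beta>}"
            using \<open>\<alpha> \<le> \<beta>\<close> by (auto simp: less_le)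
        qed
        show "x i \<in> presheaf_im V j \<alpha> i" if "i \<in> E - {\<beta>}" for i
          using that x image_subset_presheaf_im[OF S] unfolding E_def by blast
      qed (use \<open>finite E\<close> in simp)
      ultimately have "x \<beta> \<in> family_sum (V \<alpha>) {\<gamma>. \<alpha> < \<gamma> \<and> \<not> \<gamma> \<le> \<beta>} (presheaf_im V j \<alpha>)"
        using \<alpha>.subspace_uminus[OF Im] by simp
      moreover have "x \<beta> \<in> presheaf_im V j \<alpha> \<beta>"
        using \<open>x \<beta> \<in> ?W \<beta>\<close> image_subset_presheaf_im[OF S] by blast
      ultimately have "x \<beta> \<in> family_sum (V \<alpha>) {\<gamma>. \<alpha> < \<gamma> \<and> \<beta> < \<gamma>} (presheaf_im V j \<alpha>)"
        using G \<open>\<alpha> \<le> \<beta>\<close> unfolding condition_G_def by blast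
      also have "\<dots> \<subseteq> j \<alpha> \<beta> ` P \<beta>"
      proof (rule \<alpha>.family_sum_least)
        show "subspace K (j \<alpha> \<beta> ` P \<beta>) (V \<alpha>)"
          using \<open>\<alpha> \<le> \<beta>\<close> P by (rule image_subspace)
        fix \<gamma> assume "\<gamma> \<in> {\<gamma>. \<alpha> < \<gamma> \<and> \<beta> < \<gamma>}"
        then have "\<beta> < \<gamma>"
          by simp
        then have "presheaf_im V j \<beta> \<gamma> \<subseteq> P \<beta>"
          unfolding P_def
          by (intro vectorspace.family_sum_upper[OF vectorspace_V]
              vectorspace.subspace_carrier[OF vectorspace_V presheaf_im_subspace]) auto
        then show "presheaf_im V j \<alpha> \<gamma> \<subseteq> j \<alpha> \<beta> ` P \<beta>"
          using \<open>\<alpha> \<le> \<beta>\<close> \<open>\<beta> < \<gamma>\<close> by (subst presheaf_im_comp[of \<alpha> \<beta>]) auto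
      qed
      finally obtain p where p: "p \<in> P \<beta>" "x \<beta> = j \<alpha> \<beta> p"
        by blast
      obtain s where s: "s \<in> S \<beta>" "x \<beta> = j \<alpha> \<beta> s"
        using \<open>x \<beta> \<in> ?W \<beta>\<close> by blast
      \<comment> \<open>Both are preimages of \<open>x \<beta>\<close> under the injective
        \<open>j \<alpha> \<beta>\<close>; their common value lies in \<open>S \<beta>\<close> and
        in \<open>P \<beta>\<close>, hence is zero.\<close>
      have "s = p"
        using s p inj_onD[OF inj_j[OF \<open>\<alpha> \<le> \<beta>\<close>], of s p]
          vectorspace.subspace_carrier[OF vectorspace_V S]
          vectorspace.subspace_carrier[OF vectorspace_V P] by auto
      then have "s = \<zero>\<^bsub>V \<beta>\<^esub>"
        using s p SP by blast
      moreover have "j \<alpha> \<beta> \<zero>\<^bsub>V \<beta>\<^esub> = \<zero>\<^bsub>V \<alpha>\<^esub>"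
        by (rule linear_map.T0_is_0[OF linear_j[OF \<open>\<alpha> \<le> \<beta>\<close>]])
      ultimately show False
        using nz s by simp
    qed
    ultimately show ?thesis
      using span unfolding is_direct_sum_def by blast
  qed
  then show ?thesis
    using S unfolding interaction_decomposition_def by blast
qed

end

text \<open>An infinite descending chain of the reversed order is an infinite strictly ascending
  chain, which is excluded at its starting point \<open>c 0\<close>.\<close>

lemma locally_finite_dimension_imp_wf:
  assumes "locally_finite_dimension TYPE('i::order)"
  shows "wf {(\<beta>, \<alpha> :: 'i). \<alpha> < \<beta>}"
  using assms unfolding wf_iff_no_infinite_down_chain locally_finite_dimension_def by auto

theorem theorem4p5:
  fixes K :: "('k, 'r) ring_scheme"
    and V :: "'i::order \<Rightarrow> ('k, 'v, 'm) module_scheme"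
    and j :: "'i \<Rightarrow> 'i \<Rightarrow> 'v \<Rightarrow> 'v"
  assumes "linear_injective_presheaf K V j"
  shows "(condition_G V j \<and> locally_finite_dimension TYPE('i) \<longrightarrow>
            (\<exists>S. interaction_decomposition K V j S)) \<and>
         ((\<exists>S. interaction_decomposition K V j S) \<longrightarrow> condition_G V j)"
proof -
  interpret linear_injective_presheaf K V j
    by (rule assms)
  show ?thesis
    using condition_G_imp_decomposition decomposition_imp_condition_G
      locally_finite_dimension_imp_wf by blast
qed

end
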